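(* Let $n, m \geqslant 2$ be integers. Then \[ \lambda_1(\mathcal P_m(n)) - \lambda_2(\mathcal P_m(n)) < \begin{cases} 1 & \text{if } m = 2,\\ 2 & \text{otherwise,}\end{cases} \] where $\mathcal P_m(n)$ is the generalised pancake graph and $\lambda_i(\Gamma)$ denotes the $i$th largest eigenvalue (counted with multiplicity) of the adjacency matrix of a graph $\Gamma$.
   Context: Write $[n]=\{1,\dots,n\}$ and $\mathbb Z_m=\mathbb Z/m\mathbb Z$. Let $S(m,n)=\mathbb Z_m\wr S_n$ be the set of $m$-coloured permutations: pairs $\sigma=(\chi,\psi)$ with $\chi:[n]\to\mathbb Z_m$ a function (the colour function; $\chi(t)$ is the colour of the entry in position $t$) and $\psi\in S_n$ a permutation. In one-line notation, $\sigma=(\psi(1)^{\chi(1)},\dots,\psi(n)^{\chi(n)})$. For $1\le k\le n$ and $\varepsilon\in\{\pm1\}$ (superscripts $+$, $-$ abbreviate $+1$, $-1$), the prefix reversal $r_k^{\varepsilon}:S(m,n)\to S(m,n)$ is the map $(\chi,\psi)\mapsto(\chi',\psi')$ with $\psi'(t)=\psi(k+1-t)$ and $\chi'(t)=\chi(k+1-t)+\varepsilon \pmod m$ for $1\le t\le k$, and $\psi'(t)=\psi(t)$, $\chi'(t)=\chi(t)$ for $k<t\le n$. When $m=2$, $r_k^{+}=r_k^{-}$. The generalised pancake graph $\mathcal P_m(n)$ is the undirected (Cayley) graph $\mathrm{Cay}(S(m,n),R_m)$, where $R_m=\{r_k^+:1\le k\le n\}$ if $m=2$ and $R_m=\{r_k^{-}:1\le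 k\le n\}\cup\{r_k^{+}:1\le k\le n\}$ if $m\ge3$. That is, its vertices are the elements of $S(m,n)$, and two vertices are adjacent if and only if one can be obtained from the other by applying a prefix reversal $r_k^{\varepsilon}$. It is $n$-regular for $m=2$ (the burnt pancake graph) and $2n$-regular for $m\ge3$. *)

theory Defs
  imports
    "HOL-Combinatorics.Permutations"
    "HOL-Library.FuncSet"
    "Jordan_Normal_Form.Char_Poly"
begin

text \<open>
  A graph is a pair \<open>(V, E)\<close> of a vertex set and a set of unordered edges \<open>{u, v}\<close>.
\<close>

type_synonym 'a graph = "'a set \<times> 'a set set"

definition adjacency_matrix :: "'a list \<Rightarrow> 'a set set \<Rightarrow> real mat" where
  "adjacency_matrix vs E =
     mat (length vs) (length vs) (\<lambda>(i, j). if {vs ! i, vs ! j} \<in> E then 1 else 0)"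

text \<open>
  The vertices have to be put in some order to form the matrix; different orders give
  permutation-similar matrices, so the spectrum does not depend on the choice.
  The multiplicity of an eigenvalue is its multiplicity as a root of the characteristic polynomial;
  as the matrix is real and symmetric, this is also its geometric multiplicity, and the
  resulting list of real roots has length \<open>card V\<close>.
\<close>

definition graph_spectrum :: "'a graph \<Rightarrow> real multiset" where
  "graph_spectrum \<Gamma> = (case \<Gamma> of (V, E) \<Rightarrow>
     let vs = (SOME vs. distinct vs \<and> set vs = V)
     in proots (char_poly (adjacency_matrix vs E)))"

text \<open>The \<open>i\<close>th largest eigenvalue is indexed from \<open>i = 1\<close>.\<close>

definition graph_eigenvalue :: "nat \<Rightarrow> 'a graph \<Rightarrow> real" where
  "graph_eigenvalue i \<Gamma> = rev (sorted_list_of_multiset (graph_spectrum \<Gamma>)) ! (i - 1)"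

text \<open>
  The residues modulo \<open>m\<close> are represented by \<open>0, \<dots>, m - 1\<close>. To make equality of coloured
  permutations coincide with equality on \<open>{1..n}\<close>, colour functions are \<open>undefined\<close> and
  permutations are the identity outside \<open>{1..n}\<close>.
\<close>

type_synonym coloured_perm = "(nat \<Rightarrow> int) \<times> (nat \<Rightarrow> nat)"

definition coloured_perms :: "nat \<Rightarrow> nat \<Rightarrow> coloured_perm set" where
  "coloured_perms m n = ({1..n} \<rightarrow>\<^sub>E {0..<int m}) \<times> {\<psi>. \<psi> permutes {1..n}}"

definition prefix_reversal :: "nat \<Rightarrow> int \<Rightarrow> nat \<Rightarrow> coloured_perm \<Rightarrow> coloured_perm" where
  "prefix_reversal m \<epsilon> k = (\<lambda>(\<chi>, \<psi>).
     (\<lambda>t. if 1 \<le> t \<and> t \<le> k then (\<chi> (k + 1 - t) + \<epsilon>) mod int m else \<chi> t,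
      \<lambda>t. if 1 \<le> t \<and> t \<le> k then \<psi> (k + 1 - t) else \<psi> t))"

definition prefix_reversals :: "nat \<Rightarrow> nat \<Rightarrow> (coloured_perm \<Rightarrow> coloured_perm) set" where
  "prefix_reversals m n =
     (if m = 2 then {prefix_reversal m 1 k | k. 1 \<le> k \<and> k \<le> n}
      else {prefix_reversal m (-1) k | k. 1 \<le> k \<and> k \<le> n} \<union>
           {prefix_reversal m 1 k | k. 1 \<le> k \<and> k \<le> n})"

definition pancake_graph :: "nat \<Rightarrow> nat \<Rightarrow> coloured_perm graph" where
  "pancake_graph m n =
     (coloured_perms m n, {{\<sigma>, r \<sigma>} | \<sigma> r. \<sigma> \<in> coloured_perms m n \<and> r \<in> prefix_reversals m n})"

end

theory Submission
  imports Defs "HOL-Analysis.Function_Topology"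
begin

text \<open>
  The pancake graph is regular of degree \<open>s n\<close>, where \<open>s = 1\<close> for \<open>m = 2\<close> and \<open>s = 2\<close> otherwise is
  the number of signs. No eigenvalue exceeds the degree, so it suffices that at least two
  eigenvalues, with multiplicity, exceed \<open>\<mu> = s (n - 1)\<close>. The degree is one of them. By the
  variational principle (\<open>regular_graph_spectral_gap\<close>) it is enough to find a function \<open>F\<close> of sum zero on the
  coloured permutations with Rayleigh quotient greater than \<open>\<mu>\<close>.

  Follow the single pancake \<open>1\<close>. While it lies at the bottom, in position \<open>n\<close>, only the \<open>s\<close> full
  reversals move it. Hence a function \<open>P\<close> that lives on the stacks with this pancake at the bottom,
  and depends on its colour only, has Rayleigh quotient \<open>\<mu>\<close>; letting it depend on the colour with
  total sum zero makes it orthogonal to the constants. The full reversals couple \<open>P\<close> to functions on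
  the stacks with pancake \<open>1\<close> on top. Since \<open>n \<ge> 2\<close> these have disjoint support from \<open>P\<close>, and
  mixing in a small multiple of such a function, with the sign of the coupling, raises the quotient
  strictly above \<open>\<mu>\<close>: this is \<open>pancake_test_function\<close>.

  The variational principle is proved directly for a kernel with constant row sums
  (\<open>rayleigh_max_eigenfunction\<close>), and its passage to roots of the characteristic polynomial counted
  with multiplicity is \<open>char_poly_split_constant_row_sums\<close>.
\<close>

section \<open>Rayleigh quotients of symmetric kernels\<close>

lemma symmetric_kernel_swap:
  fixes a :: "'a \<Rightarrow> 'a \<Rightarrow> real"
  assumes "\<And>u v. a u v = a v u"
  shows "(\<Sum>u\<in>V. f u * (\<Sum>v\<in>V. a u v * g v)) = (\<Sum>u\<in>V. g u * (\<Sum>v\<in>V. a u v * f v))"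
proof -
  have "(\<Sum>u\<in>V. f u * (\<Sum>v\<in>V. a u v * g v)) = (\<Sum>u\<in>V. \<Sum>v\<in>V. f u * (a u v * g v))"
    by (simp add: sum_distrib_left)
  also have "\<dots> = (\<Sum>v\<in>V. \<Sum>u\<in>V. f u * (a u v * g v))" by (rule sum.swap)
  also have "\<dots> = (\<Sum>v\<in>V. g v * (\<Sum>u\<in>V. a v u * f u))"
    unfolding sum_distrib_left using assms by (intro sum.cong refl) (simp add: mult_ac)
  finally show ?thesis .
qed

text \<open>
  The first-order condition at a maximum, in algebraic form: a quadratic polynomial in \<open>t\<close> with
  value \<open>0\<close> at its maximiser \<open>t = 0\<close> has no linear term.
\<close>

lemma linear_term_vanishes:
  fixes b c :: real
  assumes "\<And>t. 2 * t * b + t\<^sup>2 * c \<le> 0"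
  shows "b = 0"
proof (rule ccontr)
  assume b: "b \<noteq> 0"
  \<comment> \<open>Small enough for the linear term to dominate the quadratic one, and of the sign that makes it
    positive.\<close>
  define t where "t = b / (\<bar>c\<bar> + 1)"
  have tb: "2 * t * b = 2 * (t\<^sup>2 * (\<bar>c\<bar> + 1))"
    unfolding t_def by (simp add: power2_eq_square)
  have "t\<^sup>2 * (2 * \<bar>c\<bar> + 2 + c) \<le> 0"
    using assms[of t] unfolding tb by (simp add: algebra_simps)
  moreover have "t\<^sup>2 > 0" using b unfolding t_def by simp
  moreover have "2 * \<bar>c\<bar> + 2 + c > 0" by linarith
  ultimately show False by (meson mult_pos_pos not_less)
qed

text \<open>
  The only part of the spectral theorem that is needed, by the variational argument. The unit sphere
  of the hyperplane of functions with sum zero is compact, so the quadratic form \<open>q\<close> of the kernel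
  attains a maximum \<open>l\<close> on it, at \<open>x\<close> say, and \<open>l > \<mu>\<close> because of \<open>F\<close>. Since the kernel is symmetric
  and has constant row sums, it maps the hyperplane to itself; hence the residual \<open>y = a x - l x\<close> is
  an admissible direction of variation, and the first-order condition in this direction says that
  \<open>y\<close> is orthogonal to itself.
\<close>

lemma rayleigh_max_eigenfunction:
  fixes a :: "'a \<Rightarrow> 'a \<Rightarrow> real"
  assumes fin: "finite V"
    and sym: "\<And>u v. a u v = a v u"
    and row: "\<And>u. u \<in> V \<Longrightarrow> (\<Sum>v\<in>V. a u v) = d"
    and F0: "(\<Sum>v\<in>V. F v) = 0"
    and FR: "(\<Sum>u\<in>V. F u * (\<Sum>v\<in>V. a u v * F v)) > \<mu> * (\<Sum>v\<in>V. (F v)\<^sup>2)"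
  obtains x l where "l > \<mu>" "(\<Sum>v\<in>V. x v) = 0" "\<exists>v\<in>V. x v \<noteq> 0"
    "\<forall>u\<in>V. (\<Sum>v\<in>V. a u v * x v) = l * x u"
proof -
  define q where "q x = (\<Sum>u\<in>V. x u * (\<Sum>v\<in>V. a u v * x v))" for x :: "'a \<Rightarrow> real"
  define nn where "nn x = (\<Sum>v\<in>V. (x v)\<^sup>2)" for x :: "'a \<Rightarrow> real"
  \<comment> \<open>Functions that vanish outside \<open>V\<close>. The bounds \<open>-1\<close> and \<open>1\<close> follow from
    \<open>nn x = 1\<close>, but they make compactness an instance of Tychonoff's theorem.\<close>
  define S where "S = PiE UNIV (\<lambda>i. if i \<in> V then {-1..1} else {0::real})
     \<inter> {x. nn x = 1} \<inter> {x. (\<Sum>v\<in>V. x v) = 0}"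
  have coord: "continuous_on UNIV (\<lambda>x. x i)" for i :: 'a
    by simp
  have cq: "continuous_on UNIV q" and cn: "continuous_on UNIV nn"
    and cs: "continuous_on UNIV (\<lambda>x::'a\<Rightarrow>real. \<Sum>v\<in>V. x v)"
    unfolding q_def nn_def by (intro continuous_intros coord)+
  have "compactin (product_topology (\<lambda>i. euclidean) UNIV)
      (PiE UNIV (\<lambda>i::'a. if i \<in> V then {-1..1} else {0::real}))"
    unfolding compactin_PiE by auto
  then have cP: "compact (PiE UNIV (\<lambda>i::'a. if i \<in> V then {-1..1} else {0::real}))"
    by (simp add: euclidean_product_topology)
  have "closed {x. nn x = 1}" "closed {x::'a\<Rightarrow>real. (\<Sum>v\<in>V. x v) = 0}"
    using cn cs by (auto intro!: closed_Collect_eq continuous_on_const)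
  then have cS: "compact S" unfolding S_def using cP by (intro compact_Int_closed)
  have nn_le: "(x v)\<^sup>2 \<le> nn x" if "v \<in> V" for x v
    unfolding nn_def using fin that by (intro member_le_sum) auto
  have nn0: "nn x \<ge> 0" for x unfolding nn_def by (simp add: sum_nonneg)
  have qs: "q (\<lambda>v. c * x v) = c\<^sup>2 * q x" for c x
    unfolding q_def by (simp add: sum_distrib_left power2_eq_square mult_ac)
  have ns: "nn (\<lambda>v. c * x v) = c\<^sup>2 * nn x" for c x
    unfolding nn_def by (simp add: sum_distrib_left power_mult_distrib)
  \<comment> \<open>The projection of a nonzero function of sum zero to \<open>S\<close>.\<close>
  define N where "N x = (\<lambda>v. if v \<in> V then (1 / sqrt (nn x)) * x v else 0)" for x
  have qN: "q (N x) = q x / nn x" and nN: "nn (N x) = 1" and NS: "N x \<in> S"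
    if x: "nn x > 0" "(\<Sum>v\<in>V. x v) = 0" for x
  proof -
    have "q (N x) = q (\<lambda>v. (1 / sqrt (nn x)) * x v)" unfolding q_def N_def by simp
    then show "q (N x) = q x / nn x" unfolding qs using x by (simp add: power_divide)
    have "nn (N x) = nn (\<lambda>v. (1 / sqrt (nn x)) * x v)" unfolding nn_def N_def by simp
    then show n1: "nn (N x) = 1" unfolding ns using x by (simp add: power_divide)
    have "\<bar>N x v\<bar> \<le> 1" if "v \<in> V" for v
      using nn_le[OF that, of "N x"] n1 by (simp add: abs_square_le_1)
    then have "N x v \<in> (if v \<in> V then {-1..1} else {0})" for v
      by (cases "v \<in> V") (use \<open>\<And>v. v \<in> V \<Longrightarrow> \<bar>N x v\<bar> \<le> 1\<close>[of v] in \<open>auto simp: N_def abs_le_iff simp del: abs_divide\<close>)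
    then have "N x \<in> PiE UNIV (\<lambda>i. if i \<in> V then {-1..1} else {0})" by (simp add: PiE_iff)
    moreover have "(\<Sum>v\<in>V. N x v) = 0"
      using x(2) unfolding N_def by (simp flip: sum_divide_distrib)
    ultimately show "N x \<in> S" using n1 unfolding S_def by simp
  qed
  have nF: "nn F > 0"
  proof (rule ccontr)
    assume "\<not> nn F > 0"
    then have nF0: "nn F = 0" using nn0[of F] by simp
    then have "F v = 0" if "v \<in> V" for v using nn_le[OF that, of F] by simp
    then have "q F = 0" unfolding q_def by simp
    then show False using FR nF0 unfolding q_def nn_def by simp
  qed
  obtain x where xS: "x \<in> S" and xmax: "\<And>y. y \<in> S \<Longrightarrow> q y \<le> q x"
    using continuous_attains_sup[OF cS, of q] NS[OF nF F0] continuous_on_subset[OF cq] by blast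
  define l where "l = q x"
  have nx: "nn x = 1" and x0: "(\<Sum>v\<in>V. x v) = 0" using xS unfolding S_def by auto
  have "q F / nn F \<le> l" using xmax[OF NS[OF nF F0]] qN[OF nF F0] unfolding l_def by simp
  then have lmu: "l > \<mu>" using FR nF unfolding q_def[symmetric] nn_def[symmetric]
    by (metis less_le_trans pos_less_divide_eq)
  have qle: "q y \<le> l * nn y" if "(\<Sum>v\<in>V. y v) = 0" for y
  proof (cases "nn y > 0")
    case True
    then show ?thesis using xmax[OF NS[OF True that]] qN[OF True that]
      unfolding l_def by (simp add: pos_divide_le_eq)
  next
    case False
    then have n0: "nn y = 0" using nn0[of y] by simp
    then have "y v = 0" if "v \<in> V" for v using nn_le[OF that, of y] by simp
    then show ?thesis using n0 unfolding q_def by simp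
  qed
  define y where "y u = (\<Sum>v\<in>V. a u v * x v) - l * x u" for u
  define y' where "y' u = (\<Sum>v\<in>V. a u v * y v)" for u
  have "(\<Sum>u\<in>V. 1 * (\<Sum>v\<in>V. a u v * x v)) = (\<Sum>u\<in>V. x u * (\<Sum>v\<in>V. a u v * 1))"
    by (rule symmetric_kernel_swap[OF sym])
  also have "\<dots> = 0" using row x0 by (simp flip: sum_distrib_right)
  finally have y0: "(\<Sum>v\<in>V. y v) = 0"
    unfolding y_def by (simp add: sum_subtractf x0 flip: sum_distrib_left)
  have swap: "(\<Sum>u\<in>V. x u * y' u) = (\<Sum>u\<in>V. y u * (\<Sum>v\<in>V. a u v * x v))"
    unfolding y'_def by (rule symmetric_kernel_swap[OF sym])
  have "2 * t * nn y + t\<^sup>2 * (q y - l * nn y) \<le> 0" for t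
  proof -
    let ?z = "\<lambda>v. x v + t * y v"
    have Az: "(\<Sum>v\<in>V. a u v * ?z v) = (\<Sum>v\<in>V. a u v * x v) + t * y' u" for u
      unfolding y'_def by (simp add: distrib_left sum.distrib sum_distrib_left mult_ac)
    have "q ?z = q x + t * (\<Sum>u\<in>V. x u * y' u)
        + t * (\<Sum>u\<in>V. y u * (\<Sum>v\<in>V. a u v * x v)) + t\<^sup>2 * q y"
      unfolding q_def Az unfolding y'_def[symmetric]
      by (simp add: algebra_simps sum.distrib sum_distrib_left power2_eq_square)
    moreover have "nn ?z = nn x + 2 * t * (\<Sum>u\<in>V. x u * y u) + t\<^sup>2 * nn y"
      unfolding nn_def
      by (simp add: algebra_simps sum.distrib sum_distrib_left power2_eq_square)
    moreover have "(\<Sum>u\<in>V. y u * (\<Sum>v\<in>V. a u v * x v)) = nn y + l * (\<Sum>u\<in>V. x u * y u)"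
    proof -
      have "y u * (\<Sum>v\<in>V. a u v * x v) = (y u)\<^sup>2 + l * (x u * y u)" for u
        unfolding y_def by (simp add: algebra_simps power2_eq_square)
      then show ?thesis unfolding nn_def by (simp add: sum.distrib sum_distrib_left)
    qed
    moreover have "q ?z \<le> l * nn ?z"
      by (rule qle) (simp add: sum.distrib x0 y0 flip: sum_distrib_left)
    ultimately show ?thesis using nx swap unfolding l_def[symmetric]
      by (simp add: algebra_simps)
  qed
  then have "nn y = 0" by (rule linear_term_vanishes)
  then have "y u = 0" if "u \<in> V" for u using nn_le[OF that, of y] by simp
  moreover have "\<exists>v\<in>V. x v \<noteq> 0"
  proof (rule ccontr)
    assume "\<not> (\<exists>v\<in>V. x v \<noteq> 0)"
    then have "nn x = 0" unfolding nn_def by simp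
    then show False using nx by simp
  qed
  ultimately show ?thesis using that[OF lmu x0] unfolding y_def by simp
qed

section \<open>Eigenvalues of matrices with constant row sums\<close>

text \<open>
  The matrix has the constant vector as right eigenvector for \<open>d\<close>, and the left eigenvector \<open>w\<close> for
  \<open>l\<close>, which is orthogonal to it. Passing to a basis whose first member is the constant vector
  splits off a block \<open>T = (d)\<close>, and \<open>w\<close> survives as a left eigenvector of the remaining block \<open>D\<close>. A
  product of linear factors is obtained, instead of just two roots, so that \<open>d = l\<close> is covered with
  its multiplicity and no connectedness of a graph has to be established.
\<close>

lemma char_poly_split_constant_row_sums:
  fixes M :: "'a :: field mat"
  assumes M: "M \<in> carrier_mat N N"
    and row: "\<And>i. i < N \<Longrightarrow> (\<Sum>j<N. M $$ (i,j)) = d"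
    and w: "\<And>j. j < N \<Longrightarrow> (\<Sum>i<N. w i * M $$ (i,j)) = l * w j"
    and w0: "(\<Sum>i<N. w i) = 0" and wn: "\<exists>i<N. w i \<noteq> 0"
  shows "[:- d, 1:] * [:- l, 1:] dvd char_poly M"
proof -
  from wn obtain k where N: "N = Suc k" by (metis less_imp_Suc_add)
  \<comment> \<open>The columns of \<open>P\<close> are the constant vector and the unit vectors other than the first; \<open>Q\<close> is
    its inverse and \<open>B\<close> is the matrix in the new basis.\<close>
  define P where "P = mat N N (\<lambda>(i,j). if i = j \<or> j = 0 then 1 else 0 :: 'a)"
  define Q where "Q = mat N N (\<lambda>(i,j). if i = j then 1 else if j = 0 then -1 else 0 :: 'a)"
  define D where "D = mat k k (\<lambda>(i,j). M $$ (Suc i, Suc j) - M $$ (0, Suc j))"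
  define R where "R = mat 1 k (\<lambda>(i,j). M $$ (0, Suc j))"
  define T where "T = mat 1 1 (\<lambda>(i,j). d)"
  define B where "B = four_block_mat T R (0\<^sub>m k 1) D"
  have carr: "T \<in> carrier_mat 1 1" "R \<in> carrier_mat 1 k" "D \<in> carrier_mat k k"
      "P \<in> carrier_mat N N" "Q \<in> carrier_mat N N"
    unfolding P_def Q_def T_def R_def D_def by auto
  have B: "B \<in> carrier_mat N N" unfolding B_def N using carr by auto
  have Bij: "B $$ (i,j) = (if j = 0 then (if i = 0 then d else 0)
      else M $$ (i,j) - (if i = 0 then 0 else M $$ (0,j)))" if "i < N" "j < N" for i j
    using that unfolding B_def T_def R_def D_def N by (cases i; cases j) auto
  have PQ: "P * Q = 1\<^sub>m N"
  proof (rule eq_matI)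
    fix i j assume ij: "i < dim_row (1\<^sub>m N)" "j < dim_col (1\<^sub>m N)"
    then have "(P * Q) $$ (i,j) = (\<Sum>t<N. P $$ (i,t) * Q $$ (t,j))"
      using carr by (simp add: scalar_prod_def atLeast0LessThan)
    also have "\<dots> = 1 * Q $$ (0,j) + (\<Sum>t<k. (if i = Suc t then Q $$ (Suc t, j) else 0))"
      using ij unfolding N by (subst sum.lessThan_Suc_shift) (auto simp: P_def N intro!: sum.cong)
    also have "\<dots> = 1\<^sub>m N $$ (i,j)"
      using ij unfolding N by (cases i) (auto simp: Q_def N)
    finally show "(P * Q) $$ (i,j) = 1\<^sub>m N $$ (i,j)" .
  qed (use carr in auto)
  have QP: "Q * P = 1\<^sub>m N" using mat_mult_left_right_inverse[OF carr(4,5) PQ] .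
  have MP: "M * P = P * B"
  proof (rule eq_matI)
    fix i j assume "i < dim_row (P * B)" "j < dim_col (P * B)"
    then have ij: "i < N" "j < N" using carr B by auto
    have "(M * P) $$ (i,j) = (\<Sum>t<N. M $$ (i,t) * P $$ (t,j))"
      using carr M ij by (simp add: scalar_prod_def atLeast0LessThan)
    also have "\<dots> = (if j = 0 then d else M $$ (i,j))"
    proof (cases "j = 0")
      case True
      then show ?thesis using row[OF ij(1)] ij by (simp add: P_def)
    next
      case False
      have "(\<Sum>t<N. M $$ (i,t) * P $$ (t,j)) = (\<Sum>t<N. if t = j then M $$ (i,t) else 0)"
        using False ij by (intro sum.cong) (auto simp: P_def)
      then show ?thesis using False ij by simp
    qed
    also have "\<dots> = B $$ (0,j) + (if i = 0 then 0 else B $$ (i,j))"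
      using ij by (auto simp: Bij)
    also have "\<dots> = 1 * B $$ (0,j) + (\<Sum>t<k. (if i = Suc t then B $$ (Suc t, j) else 0))"
      using ij unfolding N by (cases i) auto
    also have "\<dots> = (\<Sum>t<N. P $$ (i,t) * B $$ (t,j))"
      using ij unfolding N by (subst sum.lessThan_Suc_shift) (auto simp: P_def N intro!: sum.cong)
    also have "\<dots> = (P * B) $$ (i,j)"
      using carr B ij by (simp add: scalar_prod_def atLeast0LessThan)
    finally show "(M * P) $$ (i,j) = (P * B) $$ (i,j)" .
  qed (use carr B M in auto)
  have "M = M * (P * Q)" using M by (simp add: PQ)
  also have "\<dots> = P * B * Q" using assoc_mult_mat[OF M carr(4,5)] by (simp add: MP)
  finally have "similar_mat M B"
    using M B carr PQ QP by (intro similar_matI[of M B P Q N]) (auto simp: similar_mat_def)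
  then have cM: "char_poly M = char_poly T * char_poly D"
    using char_poly_similar char_poly_four_block_zeros_col[OF carr(1-3)] unfolding B_def by metis
  have "poly (char_poly T) d = 0"
    using carr(1) unfolding eigenvalue_root_char_poly[OF carr(1), symmetric] eigenvalue_def
    by (intro exI[of _ "vec 1 (\<lambda>_. 1)"])
      (auto simp: eigenvector_def T_def scalar_prod_def intro!: eq_vecI dest: arg_cong[of _ _ "\<lambda>v. v $ 0"])
  moreover have "eigenvalue (transpose_mat D) l"
  proof -
    define u where "u = vec k (\<lambda>i. w (Suc i))"
    have w0': "w 0 + (\<Sum>i<k. w (Suc i)) = 0"
      using w0 unfolding N by (simp add: sum.lessThan_Suc_shift del: sum.lessThan_Suc)
    have "u \<noteq> 0\<^sub>v k"
    proof
      assume "u = 0\<^sub>v k"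
      then have z: "w (Suc i) = 0" if "i < k" for i
        using that unfolding u_def by (metis index_vec index_zero_vec(1))
      then have "w 0 = 0" using w0' by simp
      then show False using wn z N by (metis less_Suc_eq_0_disj)
    qed
    moreover have "transpose_mat D *\<^sub>v u = l \<cdot>\<^sub>v u"
    proof (rule eq_vecI)
      fix j assume "j < dim_vec (l \<cdot>\<^sub>v u)"
      then have j: "j < k" unfolding u_def by simp
      then have "(transpose_mat D *\<^sub>v u) $ j
          = (\<Sum>i<k. (M $$ (Suc i, Suc j) - M $$ (0, Suc j)) * w (Suc i))"
        unfolding D_def u_def by (simp add: scalar_prod_def atLeast0LessThan)
      also have "\<dots> = (\<Sum>i<k. w (Suc i) * M $$ (Suc i, Suc j)) - M $$ (0, Suc j) * (\<Sum>i<k. w (Suc i))"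
        by (simp add: algebra_simps sum_subtractf sum_distrib_left)
      also have "(\<Sum>i<k. w (Suc i)) = - w 0" using w0' by (simp add: add_eq_0_iff)
      also have "(\<Sum>i<k. w (Suc i) * M $$ (Suc i, Suc j)) - M $$ (0, Suc j) * (- w 0)
          = (\<Sum>i<N. w i * M $$ (i, Suc j))"
        unfolding N by (subst sum.lessThan_Suc_shift) simp
      also have "\<dots> = l * w (Suc j)" using j by (intro w) (simp add: N)
      finally show "(transpose_mat D *\<^sub>v u) $ j = (l \<cdot>\<^sub>v u) $ j" using j unfolding u_def by simp
    qed (auto simp: u_def D_def)
    ultimately show ?thesis unfolding eigenvalue_def eigenvector_def
      by (intro exI[of _ u]) (auto simp: D_def u_def)
  qed
  then have "poly (char_poly D) l = 0"
    using carr(3) eigenvalue_root_char_poly[of "transpose_mat D" k l] by simp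
  ultimately show ?thesis unfolding cM by (intro mult_dvd_mono) (simp_all add: poly_eq_0_iff_dvd)
qed

text \<open>
  Compare the two sides of the eigenvalue equation at a coordinate \<open>i\<close> in which the eigenvector has
  largest absolute value.
\<close>

lemma eigenvalue_le_row_sum:
  fixes M :: "real mat"
  assumes M: "M \<in> carrier_mat N N"
    and nonneg: "\<And>i j. i < N \<Longrightarrow> j < N \<Longrightarrow> M $$ (i,j) \<ge> 0"
    and row: "\<And>i. i < N \<Longrightarrow> (\<Sum>j<N. M $$ (i,j)) = d"
    and ev: "eigenvalue M l"
  shows "l \<le> d"
proof -
  obtain v where v: "v \<in> carrier_vec N" "v \<noteq> 0\<^sub>v N" "M *\<^sub>v v = l \<cdot>\<^sub>v v"
    using ev M unfolding eigenvalue_def eigenvector_def by auto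
  have "\<exists>i<N. v $ i \<noteq> 0"
  proof (rule ccontr)
    assume "\<not> (\<exists>i<N. v $ i \<noteq> 0)"
    then have "v = 0\<^sub>v N" using v(1) by (intro eq_vecI) auto
    then show False using v(2) by simp
  qed
  then obtain i0 where i0: "i0 < N" "v $ i0 \<noteq> 0" by auto
  obtain i where i: "i < N" "\<And>j. j < N \<Longrightarrow> \<bar>v $ j\<bar> \<le> \<bar>v $ i\<bar>"
  proof -
    have "Max ((\<lambda>i. \<bar>v $ i\<bar>) ` {..<N}) \<in> (\<lambda>i. \<bar>v $ i\<bar>) ` {..<N}"
      using i0 by (intro Max_in) auto
    then obtain i where "i < N" "Max ((\<lambda>i. \<bar>v $ i\<bar>) ` {..<N}) = \<bar>v $ i\<bar>" by auto
    moreover from this have "\<bar>v $ j\<bar> \<le> \<bar>v $ i\<bar>" if "j < N" for j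
      using that Max_ge[of "(\<lambda>i. \<bar>v $ i\<bar>) ` {..<N}" "\<bar>v $ j\<bar>"] by auto
    ultimately show ?thesis using that by blast
  qed
  have "l * v $ i = (\<Sum>j<N. M $$ (i,j) * v $ j)"
    using arg_cong[OF v(3), of "\<lambda>z. z $ i"] M v(1) i(1)
    by (simp add: scalar_prod_def atLeast0LessThan)
  then have "\<bar>l\<bar> * \<bar>v $ i\<bar> = \<bar>\<Sum>j<N. M $$ (i,j) * v $ j\<bar>" by (metis abs_mult)
  also have "\<dots> \<le> (\<Sum>j<N. M $$ (i,j) * \<bar>v $ j\<bar>)"
    using nonneg i(1) by (intro order.trans[OF sum_abs] sum_mono) (simp add: abs_mult)
  also have "\<dots> \<le> (\<Sum>j<N. M $$ (i,j) * \<bar>v $ i\<bar>)"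
    using nonneg i by (intro sum_mono mult_left_mono) auto
  also have "\<dots> = d * \<bar>v $ i\<bar>" using row[OF i(1)] by (simp flip: sum_distrib_right)
  finally have "\<bar>l\<bar> \<le> d"
    using i(2)[OF i0(1)] i0(2) by (intro mult_right_le_imp_le[of "\<bar>l\<bar>" "\<bar>v $ i\<bar>" d]) auto
  then show ?thesis by simp
qed

text \<open>
  Both \<open>d\<close> and \<open>l\<close> count, possibly as a repeated element, so at least two elements are \<open>\<ge> l\<close> and
  the second largest one is among them.
\<close>

lemma two_largest_difference:
  fixes p :: "real multiset"
  assumes sub: "{#d, l#} \<subseteq># p" and le: "\<And>x. x \<in># p \<Longrightarrow> x \<le> d"
  shows "rev (sorted_list_of_multiset p) ! 0 - rev (sorted_list_of_multiset p) ! 1 \<le> d - l"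
proof -
  define L where "L = rev (sorted_list_of_multiset p)"
  have mL: "mset L = p" unfolding L_def by simp
  have sL: "sorted (rev L)" unfolding L_def by simp
  have "length L = size p" using mL by (metis size_mset)
  then have "length L \<ge> 2" using size_mset_mono[OF sub] by simp
  then obtain a b xs where L: "L = a # b # xs"
    by (metis Suc_le_length_iff numeral_2_eq_2)
  have ld: "l \<le> d" using le mset_subset_eqD[OF sub] by simp
  have ad: "a \<le> d" using le mL L by (metis list.set_intros(1) set_mset_mset)
  have "b \<ge> l"
  proof (rule ccontr)
    assume "\<not> b \<ge> l"
    then have bl: "b < l" by simp
    have "\<forall>x\<in>set (b # xs). x \<le> b" using sL unfolding L by (auto simp: sorted_append)
    then have "filter_mset (\<lambda>x. x \<ge> l) (mset (b # xs)) = {#}" using bl by auto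
    then have "size (filter_mset (\<lambda>x. x \<ge> l) p) \<le> 1" unfolding mL[symmetric] L by simp
    moreover have "filter_mset (\<lambda>x. x \<ge> l) {#d, l#} \<subseteq># filter_mset (\<lambda>x. x \<ge> l) p"
      using sub by (rule multiset_filter_mono)
    ultimately show False using size_mset_mono ld by fastforce
  qed
  then show ?thesis using ad unfolding L_def[symmetric] L by simp
qed

section \<open>The spectral gap of a regular graph\<close>

text \<open>
  The variational upper bound for the spectral gap of a regular graph: a function \<open>F\<close> of sum zero
  whose Rayleigh quotient exceeds \<open>\<mu>\<close> forces a second eigenvalue above \<open>\<mu>\<close>, while the largest one
  is at most the degree \<open>d\<close>.
\<close>

theorem regular_graph_spectral_gap:
  fixes V :: "'a set" and E :: "'a set set"
  defines "a \<equiv> \<lambda>u v. if {u, v} \<in> E then 1 else 0 :: real"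
  assumes fin: "finite V"
    and row: "\<And>u. u \<in> V \<Longrightarrow> (\<Sum>v\<in>V. a u v) = d"
    and F0: "(\<Sum>v\<in>V. F v) = 0"
    and FR: "(\<Sum>u\<in>V. F u * (\<Sum>v\<in>V. a u v * F v)) > \<mu> * (\<Sum>v\<in>V. (F v)\<^sup>2)"
  shows "graph_eigenvalue 1 (V, E) - graph_eigenvalue 2 (V, E) < d - \<mu>"
proof -
  have sym: "a u v = a v u" for u v unfolding a_def by (simp add: insert_commute)
  obtain x l where l: "l > \<mu>" and x0: "(\<Sum>v\<in>V. x v) = 0" and xn: "\<exists>v\<in>V. x v \<noteq> 0"
    and ev: "\<forall>u\<in>V. (\<Sum>v\<in>V. a u v * x v) = l * x u"
    by (rule rayleigh_max_eigenfunction[OF fin sym row F0 FR], assumption) (rule that)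
  define vs where "vs = (SOME vs. distinct vs \<and> set vs = V)"
  have "distinct vs \<and> set vs = V"
    unfolding vs_def by (rule someI_ex) (metis fin finite_distinct_list)
  then have vs: "distinct vs" "set vs = V" by auto
  define N where "N = length vs"
  have bij: "bij_betw ((!) vs) {..<N} V"
    using vs by (simp add: N_def bij_betw_nth)
  define M where "M = adjacency_matrix vs E"
  have M: "M \<in> carrier_mat N N" unfolding M_def adjacency_matrix_def N_def by simp
  have Mij: "M $$ (i,j) = a (vs ! i) (vs ! j)" if "i < N" "j < N" for i j
    using that unfolding M_def adjacency_matrix_def N_def a_def by simp
  have inV: "vs ! i \<in> V" if "i < N" for i using that vs unfolding N_def by auto
  have reindex: "(\<Sum>i<N. g (vs ! i)) = (\<Sum>v\<in>V. g v)" for g :: "'a \<Rightarrow> real"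
    by (rule sum.reindex_bij_betw[OF bij])
  have rowM: "(\<Sum>j<N. M $$ (i,j)) = d" if "i < N" for i
    using reindex[of "a (vs ! i)"] row[OF inV[OF that]] that by (simp add: Mij)
  have "(\<Sum>i<N. x (vs ! i) * M $$ (i,j)) = l * x (vs ! j)" if "j < N" for j
    using reindex[of "\<lambda>v. a (vs ! j) v * x v"] bspec[OF ev inV[OF that]] that
    by (simp add: Mij sym[of "vs ! j"] mult.commute)
  moreover have "(\<Sum>i<N. x (vs ! i)) = 0" using reindex x0 by simp
  moreover have "\<exists>i<N. x (vs ! i) \<noteq> 0" using xn vs unfolding N_def by (metis in_set_conv_nth)
  ultimately have "[:- d, 1:] * [:- l, 1:] dvd char_poly M"
    using char_poly_split_constant_row_sums[OF M rowM, of "\<lambda>i. x (vs ! i)" l] by blast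
  then obtain r where r: "char_poly M = [:- d, 1:] * [:- l, 1:] * r" by (elim dvdE)
  have cp0: "char_poly M \<noteq> 0" using degree_monic_char_poly[OF M] by auto
  then have r0: "r \<noteq> 0" using r by auto
  have "proots (char_poly M) = proots [:- d, 1:] + proots [:- l, 1:] + proots r"
    unfolding r using r0 by (subst proots_mult | simp)+
  then have "{#d, l#} \<subseteq># proots (char_poly M)" by simp
  moreover have "t \<le> d" if "t \<in># proots (char_poly M)" for t
  proof -
    have "poly (char_poly M) t = 0" using that cp0 by simp
    then have "eigenvalue M t" using eigenvalue_root_char_poly[OF M] by simp
    then show ?thesis using eigenvalue_le_row_sum[OF M _ rowM] by (simp add: Mij a_def)
  qed
  ultimately have "rev (sorted_list_of_multiset (proots (char_poly M))) ! 0
      - rev (sorted_list_of_multiset (proots (char_poly M))) ! 1 \<le> d - l"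
    by (rule two_largest_difference)
  then show ?thesis using l
    unfolding graph_eigenvalue_def graph_spectrum_def M_def vs_def by simp
qed

section \<open>Neighbours in the pancake graph\<close>

text \<open>
  A single sign for \<open>m = 2\<close>, where both signs give the same reversals: in this way the pairs of a
  sign and a length parametrise the neighbours of a vertex without repetition, whatever \<open>m\<close> is.
\<close>

definition reversal_signs :: "nat \<Rightarrow> int set" where
  "reversal_signs m = (if m = 2 then {1} else {1, -1})"

lemma prefix_reversals_eq:
  "prefix_reversals m n =
     (\<lambda>(\<epsilon>, k). prefix_reversal m \<epsilon> k) ` (reversal_signs m \<times> {1..n})"
  unfolding prefix_reversals_def reversal_signs_def by (auto simp: image_iff)

lemma fst_prefix_reversal:
  "fst (prefix_reversal m \<epsilon> k \<sigma>) t =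
     (if 1 \<le> t \<and> t \<le> k then (fst \<sigma> (k + 1 - t) + \<epsilon>) mod int m else fst \<sigma> t)"
  by (simp add: prefix_reversal_def split_beta)

lemma snd_prefix_reversal:
  "snd (prefix_reversal m \<epsilon> k \<sigma>) t = (if 1 \<le> t \<and> t \<le> k then snd \<sigma> (k + 1 - t) else snd \<sigma> t)"
  by (simp add: prefix_reversal_def split_beta)

lemma finite_coloured_perms: "finite (coloured_perms m n)"
  unfolding coloured_perms_def by (intro finite_cartesian_product finite_PiE finite_permutations) auto

lemma prefix_reversal_closed:
  assumes "\<sigma> \<in> coloured_perms m n" "k \<le> n" "m > 0"
  shows "prefix_reversal m \<epsilon> k \<sigma> \<in> coloured_perms m n"
proof -
  define \<rho> where "\<rho> t = (if 1 \<le> t \<and> t \<le> k then k + 1 - t else t)" for t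
  have "bij_betw \<rho> {1..n} {1..n}"
    by (rule bij_betw_byWitness[where f' = \<rho>]) (use assms(2) in \<open>auto simp: \<rho>_def\<close>)
  then have "\<rho> permutes {1..n}"
    by (rule bij_imp_permutes) (use assms(2) in \<open>auto simp: \<rho>_def\<close>)
  moreover have "snd \<sigma> permutes {1..n}" using assms(1) unfolding coloured_perms_def by auto
  ultimately have "(snd \<sigma> \<circ> \<rho>) permutes {1..n}" by (rule permutes_compose)
  moreover have "snd (prefix_reversal m \<epsilon> k \<sigma>) = snd \<sigma> \<circ> \<rho>"
    by (auto simp: snd_prefix_reversal \<rho>_def)
  moreover have "fst (prefix_reversal m \<epsilon> k \<sigma>) \<in> {1..n} \<rightarrow>\<^sub>E {0..<int m}"
    using assms unfolding coloured_perms_def by (auto simp: PiE_iff fst_prefix_reversal extensional_def)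
  ultimately show ?thesis unfolding coloured_perms_def by (simp add: mem_Times_iff)
qed

lemma prefix_reversal_cancel:
  assumes "\<sigma> \<in> coloured_perms m n" "k \<le> n"
    and neg: "int m dvd \<epsilon> + \<epsilon>'"
  shows "prefix_reversal m \<epsilon>' k (prefix_reversal m \<epsilon> k \<sigma>) = \<sigma>"
proof (rule prod_eqI; rule ext)
  fix t
  show "snd (prefix_reversal m \<epsilon>' k (prefix_reversal m \<epsilon> k \<sigma>)) t = snd \<sigma> t"
    by (auto simp: snd_prefix_reversal)
  have "((x + \<epsilon>) mod int m + \<epsilon>') mod int m = x mod int m" for x
    using neg by (metis add.assoc add.right_neutral mod_add_left_eq mod_add_right_eq dvd_imp_mod_0)
  moreover have "fst \<sigma> t mod int m = fst \<sigma> t" if "1 \<le> t" "t \<le> k"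
    using assms(1,2) that unfolding coloured_perms_def by (auto simp: PiE_iff)
  ultimately show "fst (prefix_reversal m \<epsilon>' k (prefix_reversal m \<epsilon> k \<sigma>)) t = fst \<sigma> t"
    by (auto simp: fst_prefix_reversal)
qed

text \<open>
  The length of a reversal can be read off from the pancake that it brings to the top, and the sign
  from the new colour of that pancake, as \<open>1\<close> and \<open>-1\<close> are congruent modulo \<open>m\<close> only for \<open>m = 2\<close>.
\<close>

lemma inj_on_prefix_reversal:
  assumes "\<sigma> \<in> coloured_perms m n" "m \<ge> 2"
  shows "inj_on (\<lambda>(\<epsilon>, k). prefix_reversal m \<epsilon> k \<sigma>) (reversal_signs m \<times> {1..n})"
proof (rule inj_onI, clarify)
  fix \<epsilon> k \<epsilon>' k'
  assume e: "\<epsilon> \<in> reversal_signs m" "\<epsilon>' \<in> reversal_signs m" and k: "k \<in> {1..n}" "k' \<in> {1..n}"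
    and eq: "prefix_reversal m \<epsilon> k \<sigma> = prefix_reversal m \<epsilon>' k' \<sigma>"
  have p: "snd \<sigma> permutes {1..n}" using assms(1) unfolding coloured_perms_def by auto
  have "snd \<sigma> k = snd \<sigma> k'"
    using arg_cong[OF eq, of "\<lambda>\<tau>. snd \<tau> 1"] k by (simp add: snd_prefix_reversal)
  then have kk: "k = k'" using permutes_inj[OF p] by (meson injD)
  have "(fst \<sigma> k + \<epsilon>) mod int m = (fst \<sigma> k + \<epsilon>') mod int m"
    using arg_cong[OF eq, of "\<lambda>\<tau>. fst \<tau> 1"] k kk by (simp add: fst_prefix_reversal)
  then have dv: "int m dvd \<epsilon> - \<epsilon>'" by (simp add: mod_eq_dvd_iff)
  have "\<epsilon> = \<epsilon>'"
  proof (rule ccontr)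
    assume "\<epsilon> \<noteq> \<epsilon>'"
    then have m: "m \<noteq> 2" and "\<bar>\<epsilon> - \<epsilon>'\<bar> = 2" using e by (auto simp: reversal_signs_def split: if_splits)
    then have "int m \<le> 2" using dvd_imp_le_int[OF _ dv] by auto
    then show False using m assms(2) by simp
  qed
  then show "\<epsilon> = \<epsilon>' \<and> k = k'" using kk by simp
qed

lemma reversal_signs_inverse:
  assumes "\<epsilon> \<in> reversal_signs m"
  obtains \<epsilon>' where "\<epsilon>' \<in> reversal_signs m" "int m dvd \<epsilon> + \<epsilon>'"
proof (cases "m = 2")
  case True
  then show ?thesis using assms that[of 1] by (simp add: reversal_signs_def)
next
  case False
  then show ?thesis using assms that[of "- \<epsilon>"] by (auto simp: reversal_signs_def)
qed

text \<open>
  An edge is unordered, so \<open>\<sigma>\<close> may be either the argument or the value of the reversal that defines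
  it; the generating set is closed under inverses, and the two cases agree.
\<close>

lemma pancake_adjacent_iff:
  assumes \<sigma>: "\<sigma> \<in> coloured_perms m n" and m: "m \<ge> 2"
  shows "{\<sigma>, \<tau>} \<in> snd (pancake_graph m n) \<longleftrightarrow>
     \<tau> \<in> (\<lambda>(\<epsilon>, k). prefix_reversal m \<epsilon> k \<sigma>) ` (reversal_signs m \<times> {1..n})" (is "?L \<longleftrightarrow> ?R")
proof
  assume ?L
  then obtain \<sigma>' \<epsilon> k where s: "\<sigma>' \<in> coloured_perms m n" "\<epsilon> \<in> reversal_signs m" "k \<in> {1..n}"
    and eq: "{\<sigma>, \<tau>} = {\<sigma>', prefix_reversal m \<epsilon> k \<sigma>'}"
    unfolding pancake_graph_def prefix_reversals_eq by auto
  from eq consider "\<sigma>' = \<sigma>" "\<tau> = prefix_reversal m \<epsilon> k \<sigma>" | "\<sigma>' = \<tau>" "\<sigma> = prefix_reversal m \<epsilon> k \<tau>"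
    by (metis doubleton_eq_iff)
  then show ?R
  proof cases
    case 1
    then show ?thesis using s by auto
  next
    case 2
    obtain \<epsilon>' where e: "\<epsilon>' \<in> reversal_signs m" "int m dvd \<epsilon> + \<epsilon>'"
      using reversal_signs_inverse[OF s(2)] .
    have "\<tau> = prefix_reversal m \<epsilon>' k \<sigma>"
      using prefix_reversal_cancel[OF s(1) _ e(2), of k] s(3) 2 by simp
    then show ?thesis using e s(3) by auto
  qed
next
  assume ?R
  then obtain \<epsilon> k where "\<epsilon> \<in> reversal_signs m" "k \<in> {1..n}" "\<tau> = prefix_reversal m \<epsilon> k \<sigma>" by auto
  then have "\<exists>r\<in>prefix_reversals m n. \<tau> = r \<sigma>" unfolding prefix_reversals_eq by force
  then obtain r where "r \<in> prefix_reversals m n" "\<tau> = r \<sigma>" by blast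
  then show ?L unfolding pancake_graph_def snd_conv using \<sigma> by blast
qed

lemma sum_over_neighbours:
  fixes g :: "coloured_perm \<Rightarrow> real"
  assumes \<sigma>: "\<sigma> \<in> coloured_perms m n" and m: "m \<ge> 2"
  shows "(\<Sum>\<tau>\<in>coloured_perms m n. (if {\<sigma>, \<tau>} \<in> snd (pancake_graph m n) then 1 else 0) * g \<tau>)
    = (\<Sum>\<epsilon>\<in>reversal_signs m. \<Sum>k\<in>{1..n}. g (prefix_reversal m \<epsilon> k \<sigma>))" (is "?L = ?R")
proof -
  define nb where "nb = (\<lambda>(\<epsilon>, k). prefix_reversal m \<epsilon> k \<sigma>) ` (reversal_signs m \<times> {1..n})"
  have "nb \<subseteq> coloured_perms m n"
    unfolding nb_def using prefix_reversal_closed[OF \<sigma>] m by auto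
  have "?L = (\<Sum>\<tau>\<in>coloured_perms m n. if \<tau> \<in> nb then g \<tau> else 0)"
    unfolding pancake_adjacent_iff[OF \<sigma> m] nb_def[symmetric] by (intro sum.cong) auto
  also have "\<dots> = (\<Sum>\<tau>\<in>nb. g \<tau>)"
    using \<open>nb \<subseteq> _\<close> finite_coloured_perms by (simp add: sum.inter_restrict[symmetric] inf.absorb2)
  also have "\<dots> = (\<Sum>(\<epsilon>, k)\<in>reversal_signs m \<times> {1..n}. g (prefix_reversal m \<epsilon> k \<sigma>))"
    unfolding nb_def by (subst sum.reindex[OF inj_on_prefix_reversal[OF \<sigma> m]]) (simp add: split_beta)
  also have "\<dots> = ?R" by (simp add: sum.cartesian_product)
  finally show ?thesis .
qed

section \<open>A test function with large Rayleigh quotient\<close>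

text \<open>
  Among the coloured permutations with pancake \<open>1\<close> in position \<open>q\<close>, each colour of this pancake
  occurs equally often, since the colours of the positions are chosen independently.
\<close>

lemma sum_colour_of_pancake_at:
  assumes q: "q \<in> {1..n}" and m: "m > 0"
  obtains K where "(K :: real) > 0"
    "\<And>G. (\<Sum>\<sigma>\<in>coloured_perms m n. if snd \<sigma> q = 1 then G (fst \<sigma> q) else 0) = K * (\<Sum>c\<in>{0..<int m}. G c)"
proof -
  define \<Omega> where "\<Omega> = {\<psi>. \<psi> permutes {1..n} \<and> \<psi> q = 1}"
  define K where "K = real (card \<Omega>) * real m ^ (n - 1)"
  have fin: "finite {\<psi>. \<psi> permutes {1..n}}" by (intro finite_permutations) simp
  have "transpose q 1 \<in> \<Omega>" unfolding \<Omega>_def using q by (auto intro!: permutes_swap_id)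
  moreover have "finite \<Omega>" unfolding \<Omega>_def using fin by (rule rev_finite_subset) auto
  ultimately have "card \<Omega> > 0" by (auto simp: card_gt_0_iff)
  then have K: "K > 0" using m unfolding K_def by simp
  have "(\<Sum>\<sigma>\<in>coloured_perms m n. if snd \<sigma> q = 1 then G (fst \<sigma> q) else 0)
      = K * (\<Sum>c\<in>{0..<int m}. G c)" for G :: "int \<Rightarrow> real"
  proof -
    have "(\<Sum>\<chi>\<in>{1..n} \<rightarrow>\<^sub>E {0..<int m}. G (\<chi> q))
        = (\<Sum>\<chi>\<in>{1..n} \<rightarrow>\<^sub>E {0..<int m}. \<Prod>i\<in>{1..n}. if i = q then G (\<chi> i) else 1)"
      using q by simp
    also have "\<dots> = (\<Prod>i\<in>{1..n}. \<Sum>c\<in>{0..<int m}. if i = q then G c else 1)"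
      by (rule prod_sum_PiE[symmetric]) auto
    also have "\<dots> = (\<Sum>c\<in>{0..<int m}. G c) * (\<Prod>i\<in>{1..n}-{q}. real m)"
      using q by (subst prod.remove[of _ q]) (auto intro!: prod.cong)
    also have "(\<Prod>i\<in>{1..n}-{q}. real m) = real m ^ (n - 1)" using q by simp
    finally have col: "(\<Sum>\<chi>\<in>{1..n} \<rightarrow>\<^sub>E {0..<int m}. G (\<chi> q))
        = (\<Sum>c\<in>{0..<int m}. G c) * real m ^ (n - 1)" .
    have "(\<Sum>\<sigma>\<in>coloured_perms m n. if snd \<sigma> q = 1 then G (fst \<sigma> q) else 0)
        = (\<Sum>\<chi>\<in>{1..n} \<rightarrow>\<^sub>E {0..<int m}. \<Sum>\<psi>\<in>{\<psi>. \<psi> permutes {1..n}}. if \<psi> q = 1 then G (\<chi> q) else 0)"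
      unfolding coloured_perms_def by (simp add: sum.cartesian_product split_beta)
    also have "\<dots> = (\<Sum>\<chi>\<in>{1..n} \<rightarrow>\<^sub>E {0..<int m}. real (card \<Omega>) * G (\<chi> q))"
      using fin by (intro sum.cong refl, subst sum.inter_filter[symmetric]) (auto simp: \<Omega>_def)
    finally show ?thesis using col unfolding K_def by (simp flip: sum_distrib_left)
  qed
  then show ?thesis using that K by blast
qed

text \<open>
  The difference of the indicator functions of the colours \<open>0\<close> and \<open>1\<close>. It stands in for a
  nontrivial character of \<open>\<int>/m\<close>. What matters is that its sum is zero and that it correlates with its
  own shift by the signs (\<open>sum_wave_shifted_wave\<close>). For a character \<open>\<omega>\<close> this correlation is
  proportional to the real part of \<open>\<omega>(1)\<close> and may vanish, as for \<open>\<omega>(1) = i\<close>; for this function it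
  is \<open>-2\<close> uniformly in \<open>m\<close>.
\<close>

definition colour_wave :: "int \<Rightarrow> real" where
  "colour_wave c = (if c = 0 then 1 else if c = 1 then -1 else 0)"

lemma sum_colour_wave:
  assumes "m \<ge> 2"
  shows "(\<Sum>c\<in>{0..<int m}. colour_wave c * G c) = G 0 - G 1"
proof -
  have "{0..<int m} = insert 0 (insert 1 {2..<int m})" using assms by auto
  moreover have "(\<Sum>c\<in>{2..<int m}. colour_wave c * G c) = 0"
    by (intro sum.neutral) (auto simp: colour_wave_def)
  ultimately show ?thesis by (simp add: colour_wave_def)
qed

text \<open>
  The operator that the adjacency matrix induces on colours, applied to \<open>colour_wave\<close>: a reversal of
  either sign shifts the colour of every pancake that it moves.
\<close>

definition shifted_wave :: "nat \<Rightarrow> int \<Rightarrow> real" where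
  "shifted_wave m c = (\<Sum>\<epsilon>\<in>reversal_signs m. colour_wave ((c + \<epsilon>) mod int m))"

lemma sum_wave_shifted_wave:
  assumes "m \<ge> 2"
  shows "(\<Sum>c\<in>{0..<int m}. colour_wave c * shifted_wave m c) = -2"
proof (cases "m = 2")
  case True
  then show ?thesis unfolding sum_colour_wave[OF assms]
    by (simp add: shifted_wave_def reversal_signs_def colour_wave_def)
next
  case False
  have "(- 1) mod int m = int m - 1" using assms by (simp add: zmod_minus1)
  moreover have "1 mod int m = 1" "2 mod int m = 2" using assms False by auto
  ultimately show ?thesis using assms False unfolding sum_colour_wave[OF assms]
    by (simp add: shifted_wave_def reversal_signs_def colour_wave_def)
qed

definition pancake_wave :: "nat \<Rightarrow> coloured_perm \<Rightarrow> real" where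
  "pancake_wave q \<sigma> = (if snd \<sigma> q = 1 then colour_wave (fst \<sigma> q) else 0)"

text \<open>
  Only the full reversal moves the pancake at the bottom (position \<open>n\<close>), so all other generators fix
  the function; and only the full reversal brings a pancake to the bottom, namely the top one.
\<close>

lemma adjacency_bottom_wave:
  assumes n: "n \<ge> 1"
  shows "(\<Sum>\<epsilon>\<in>reversal_signs m. \<Sum>k\<in>{1..n}. pancake_wave n (prefix_reversal m \<epsilon> k \<sigma>))
    = real (card (reversal_signs m)) * real (n - 1) * pancake_wave n \<sigma>
      + (if snd \<sigma> 1 = 1 then shifted_wave m (fst \<sigma> 1) else 0)"
proof -
  have "(\<Sum>k\<in>{1..n}. pancake_wave n (prefix_reversal m \<epsilon> k \<sigma>))
      = real (n - 1) * pancake_wave n \<sigma>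
        + (if snd \<sigma> 1 = 1 then colour_wave ((fst \<sigma> 1 + \<epsilon>) mod int m) else 0)" for \<epsilon>
  proof -
    have "(\<Sum>k\<in>{1..n}. pancake_wave n (prefix_reversal m \<epsilon> k \<sigma>))
        = pancake_wave n (prefix_reversal m \<epsilon> n \<sigma>)
          + (\<Sum>k\<in>{1..n}-{n}. pancake_wave n (prefix_reversal m \<epsilon> k \<sigma>))"
      using n by (intro sum.remove) auto
    also have "(\<Sum>k\<in>{1..n}-{n}. pancake_wave n (prefix_reversal m \<epsilon> k \<sigma>))
        = (\<Sum>k\<in>{1..n}-{n}. pancake_wave n \<sigma>)"
      by (intro sum.cong refl) (auto simp: pancake_wave_def fst_prefix_reversal snd_prefix_reversal)
    also have "\<dots> = real (n - 1) * pancake_wave n \<sigma>" using n by simp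
    finally show ?thesis
      using n by (simp add: pancake_wave_def fst_prefix_reversal snd_prefix_reversal)
  qed
  then show ?thesis by (simp add: sum.distrib shifted_wave_def)
qed

text \<open>
  Whatever position \<open>q\<close> pancake \<open>1\<close> has, it is brought to the top by reversing the prefix of length
  \<open>q\<close> and by no other length.
\<close>

lemma adjacency_top_wave:
  assumes p: "snd \<sigma> permutes {1..n}" and q: "q \<in> {1..n}" "snd \<sigma> q = 1"
  shows "(\<Sum>\<epsilon>\<in>reversal_signs m. \<Sum>k\<in>{1..n}. pancake_wave 1 (prefix_reversal m \<epsilon> k \<sigma>))
    = shifted_wave m (fst \<sigma> q)"
proof -
  have qk: "snd \<sigma> k = 1 \<longleftrightarrow> k = q" for k using permutes_inj[OF p] q(2) by (metis injD)
  have "(\<Sum>k\<in>{1..n}. pancake_wave 1 (prefix_reversal m \<epsilon> k \<sigma>))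
     = (\<Sum>k\<in>{1..n}. if k = q then colour_wave ((fst \<sigma> q + \<epsilon>) mod int m) else 0)" for \<epsilon>
    by (intro sum.cong refl) (auto simp: pancake_wave_def fst_prefix_reversal snd_prefix_reversal qk qk[unfolded One_nat_def])
  then show ?thesis using q(1) by (simp add: shifted_wave_def)
qed

text \<open>
  Let \<open>P\<close> and \<open>Q\<close> be \<open>colour_wave\<close> of the colour of pancake \<open>1\<close>, restricted to its being at the
  bottom and at the top respectively. \<open>P\<close> alone has Rayleigh quotient exactly \<open>\<mu>\<close>: it is fixed by the
  \<open>n - 1\<close> shorter reversals and has disjoint support from its image under the full ones. It is not an
  eigenfunction, however, because the full reversals couple it with \<open>Q\<close>, with negative sign. So the
  quotient of \<open>P - \<delta> Q\<close> gains a term linear in \<open>\<delta>\<close> and loses only a quadratic one, and exceeds \<open>\<mu>\<close>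
  for small \<open>\<delta> > 0\<close>.
\<close>

lemma pancake_test_function:
  assumes n: "n \<ge> 2" and m: "m \<ge> 2"
  defines "\<mu> \<equiv> real (card (reversal_signs m)) * real (n - 1)"
  obtains F :: "coloured_perm \<Rightarrow> real" where
    "(\<Sum>\<sigma>\<in>coloured_perms m n. F \<sigma>) = 0"
    "(\<Sum>\<sigma>\<in>coloured_perms m n. F \<sigma> * (\<Sum>\<epsilon>\<in>reversal_signs m. \<Sum>k\<in>{1..n}. F (prefix_reversal m \<epsilon> k \<sigma>)))
       > \<mu> * (\<Sum>\<sigma>\<in>coloured_perms m n. (F \<sigma>)\<^sup>2)"
proof -
  let ?V = "coloured_perms m n"
  let ?A = "\<lambda>F \<sigma>. \<Sum>\<epsilon>\<in>reversal_signs m. \<Sum>k\<in>{1..n}. F (prefix_reversal m \<epsilon> k \<sigma>) :: real"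
  let ?h = colour_wave and ?s = "shifted_wave m"
  let ?at = "\<lambda>q G \<sigma>. if snd \<sigma> q = 1 then G (fst \<sigma> q) else 0 :: real"
  have \<mu>0: "\<mu> \<ge> 0" unfolding \<mu>_def by simp
  \<comment> \<open>With this value the terms that involve \<open>K1\<close> cancel in the final comparison.\<close>
  define \<delta> where "\<delta> = 1 / (1 + \<mu>)"
  have \<delta>: "\<delta> > 0" "\<delta> * (1 + \<mu>) = 1" using \<mu>0 unfolding \<delta>_def by auto
  define F where "F \<sigma> = pancake_wave n \<sigma> - \<delta> * pancake_wave 1 \<sigma>" for \<sigma>
  obtain Kn where Kn: "(Kn :: real) > 0"
    "\<And>G. (\<Sum>\<sigma>\<in>?V. ?at n G \<sigma>) = Kn * (\<Sum>c\<in>{0..<int m}. G c)"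
    using sum_colour_of_pancake_at[of n n m] n m by auto
  obtain K1 where K1: "(K1 :: real) > 0"
    "\<And>G. (\<Sum>\<sigma>\<in>?V. ?at 1 G \<sigma>) = K1 * (\<Sum>c\<in>{0..<int m}. G c)"
    using sum_colour_of_pancake_at[of 1 n m] n m by auto
  have h0: "(\<Sum>c\<in>{0..<int m}. ?h c) = 0"
    using sum_colour_wave[OF m, of "\<lambda>_. 1"] by simp
  have h2: "(\<Sum>c\<in>{0..<int m}. ?h c * ?h c) = 2"
    using sum_colour_wave[OF m, of ?h] by (simp add: colour_wave_def)
  have hs: "(\<Sum>c\<in>{0..<int m}. ?h c * ?s c) = -2" by (rule sum_wave_shifted_wave[OF m])
  have F0: "(\<Sum>\<sigma>\<in>?V. F \<sigma>) = 0"
    unfolding F_def pancake_wave_def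
    using Kn(2)[of ?h] K1(2)[of ?h] by (simp add: sum_subtractf h0 flip: sum_distrib_left)
  have FA: "F \<sigma> * ?A F \<sigma> = ?at n (\<lambda>c. \<mu> * (?h c * ?h c) - \<delta> * (?h c * ?s c)) \<sigma>
      + ?at 1 (\<lambda>c. - \<delta> * (1 - \<delta>) * (?h c * ?s c)) \<sigma>" (is "_ = ?R \<sigma>")
    and FF: "(F \<sigma>)\<^sup>2 = ?at n (\<lambda>c. ?h c * ?h c) \<sigma> + ?at 1 (\<lambda>c. \<delta>\<^sup>2 * (?h c * ?h c)) \<sigma>"
    if "\<sigma> \<in> ?V" for \<sigma>
  proof -
    have p: "snd \<sigma> permutes {1..n}" using that unfolding coloured_perms_def by auto
    have excl: "snd \<sigma> n = 1 \<Longrightarrow> snd \<sigma> 1 \<noteq> 1"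
      using permutes_inj[OF p] n by (metis injD not_one_le_zero numeral_le_one_iff semiring_norm(69))
    have AF: "?A F \<sigma> = ?A (pancake_wave n) \<sigma> - \<delta> * ?A (pancake_wave 1) \<sigma>"
      unfolding F_def by (simp add: sum_subtractf sum_distrib_left)
    have An: "?A (pancake_wave n) \<sigma> = \<mu> * pancake_wave n \<sigma> + ?at 1 ?s \<sigma>"
      using adjacency_bottom_wave[of n m \<sigma>] n unfolding \<mu>_def by simp
    have A1: "?A (pancake_wave 1) \<sigma> = ?s (fst \<sigma> q)" if "q \<in> {1..n}" "snd \<sigma> q = 1" for q
      by (rule adjacency_top_wave[OF p that])
    consider "snd \<sigma> n = 1" | "snd \<sigma> n \<noteq> 1" "snd \<sigma> 1 = 1" | "snd \<sigma> n \<noteq> 1" "snd \<sigma> 1 \<noteq> 1" by blast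
    then show "F \<sigma> * ?A F \<sigma> = ?R \<sigma>"
    proof cases
      case 1
      have "?A F \<sigma> = \<mu> * ?h (fst \<sigma> n) - \<delta> * ?s (fst \<sigma> n)"
        using 1 excl n unfolding AF An by (subst A1[of n]) (auto simp: pancake_wave_def)
      moreover have "F \<sigma> = ?h (fst \<sigma> n)" using 1 excl by (simp add: F_def pancake_wave_def)
      ultimately have "F \<sigma> * ?A F \<sigma> = ?h (fst \<sigma> n) * (\<mu> * ?h (fst \<sigma> n) - \<delta> * ?s (fst \<sigma> n))"
        by (simp only:)
      then show ?thesis using 1 excl by (simp add: algebra_simps)
    next
      case 2
      have "?A F \<sigma> = (1 - \<delta>) * ?s (fst \<sigma> 1)"
        using 2 n unfolding AF An by (subst A1[of 1]) (auto simp: pancake_wave_def algebra_simps)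
      moreover have "F \<sigma> = - \<delta> * ?h (fst \<sigma> 1)" using 2 by (simp add: F_def pancake_wave_def)
      ultimately have "F \<sigma> * ?A F \<sigma> = - \<delta> * ?h (fst \<sigma> 1) * ((1 - \<delta>) * ?s (fst \<sigma> 1))"
        by (simp only:)
      then show ?thesis using 2 by (simp add: algebra_simps)
    next
      case 3
      then have "F \<sigma> = 0" by (simp add: F_def pancake_wave_def)
      then show ?thesis using 3 by simp
    qed
    show "(F \<sigma>)\<^sup>2 = ?at n (\<lambda>c. ?h c * ?h c) \<sigma> + ?at 1 (\<lambda>c. \<delta>\<^sup>2 * (?h c * ?h c)) \<sigma>"
      using excl by (auto simp: F_def pancake_wave_def power2_eq_square)
  qed
  have "(\<Sum>\<sigma>\<in>?V. F \<sigma> * ?A F \<sigma>) = Kn * (2 * \<mu> + 2 * \<delta>) + K1 * (2 * \<delta> * (1 - \<delta>))"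
  proof -
    have "(\<Sum>\<sigma>\<in>?V. F \<sigma> * ?A F \<sigma>)
        = Kn * (\<Sum>c\<in>{0..<int m}. \<mu> * (?h c * ?h c) - \<delta> * (?h c * ?s c))
          + K1 * (\<Sum>c\<in>{0..<int m}. - \<delta> * (1 - \<delta>) * (?h c * ?s c))"
      using Kn(2)[of "\<lambda>c. \<mu> * (?h c * ?h c) - \<delta> * (?h c * ?s c)"]
        K1(2)[of "\<lambda>c. - \<delta> * (1 - \<delta>) * (?h c * ?s c)"]
      by (simp only: sum.cong[OF refl FA] sum.distrib)
    then show ?thesis by (simp only: sum_subtractf h2 hs flip: sum_distrib_left) simp
  qed
  moreover have "(\<Sum>\<sigma>\<in>?V. (F \<sigma>)\<^sup>2) = Kn * 2 + K1 * (2 * \<delta>\<^sup>2)"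
  proof -
    have "(\<Sum>\<sigma>\<in>?V. (F \<sigma>)\<^sup>2)
        = Kn * (\<Sum>c\<in>{0..<int m}. ?h c * ?h c) + K1 * (\<Sum>c\<in>{0..<int m}. \<delta>\<^sup>2 * (?h c * ?h c))"
      using Kn(2)[of "\<lambda>c. ?h c * ?h c"] K1(2)[of "\<lambda>c. \<delta>\<^sup>2 * (?h c * ?h c)"]
      by (simp only: sum.cong[OF refl FF] sum.distrib)
    then show ?thesis by (simp only: h2 flip: sum_distrib_left)
  qed
  ultimately have "(\<Sum>\<sigma>\<in>?V. F \<sigma> * ?A F \<sigma>) - \<mu> * (\<Sum>\<sigma>\<in>?V. (F \<sigma>)\<^sup>2)
      = 2 * \<delta> * Kn + 2 * \<delta> * K1 * (1 - \<delta> * (1 + \<mu>))"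
    by (simp add: algebra_simps power2_eq_square)
  also have "\<dots> > 0" using \<delta> Kn(1) by simp
  finally show ?thesis using that[OF F0] by simp
qed

section \<open>The spectral gap of the pancake graph\<close>

theorem theorem1p1:
  fixes m n :: nat
  assumes "n \<ge> 2" and "m \<ge> 2"
  shows "graph_eigenvalue 1 (pancake_graph m n) - graph_eigenvalue 2 (pancake_graph m n)
           < (if m = 2 then 1 else 2)"
proof -
  define s where "s = real (card (reversal_signs m))"
  let ?V = "coloured_perms m n" and ?E = "snd (pancake_graph m n)"
  note nb = sum_over_neighbours[OF _ assms(2)]
  obtain F :: "coloured_perm \<Rightarrow> real" where F0: "(\<Sum>\<sigma>\<in>?V. F \<sigma>) = 0"
    and FR: "(\<Sum>\<sigma>\<in>?V. F \<sigma> * (\<Sum>\<epsilon>\<in>reversal_signs m. \<Sum>k\<in>{1..n}. F (prefix_reversal m \<epsilon> k \<sigma>)))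
       > s * real (n - 1) * (\<Sum>\<sigma>\<in>?V. (F \<sigma>)\<^sup>2)"
    unfolding s_def by (rule pancake_test_function[OF assms])
  have "graph_eigenvalue 1 (?V, ?E) - graph_eigenvalue 2 (?V, ?E) < s * real n - s * real (n - 1)"
  proof (rule regular_graph_spectral_gap[OF finite_coloured_perms _ F0])
    show "(\<Sum>\<tau>\<in>?V. if {\<sigma>, \<tau>} \<in> ?E then 1 else 0) = s * real n" if "\<sigma> \<in> ?V" for \<sigma>
      using nb[OF that, of "\<lambda>_. 1"] unfolding s_def by simp
    show "(\<Sum>\<sigma>\<in>?V. F \<sigma> * (\<Sum>\<tau>\<in>?V. (if {\<sigma>, \<tau>} \<in> ?E then 1 else 0) * F \<tau>))
        > s * real (n - 1) * (\<Sum>\<sigma>\<in>?V. (F \<sigma>)\<^sup>2)"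
      using FR by (simp only: nb cong: sum.cong)
  qed
  moreover have "pancake_graph m n = (?V, ?E)" by (simp add: pancake_graph_def)
  moreover have "s * real n - s * real (n - 1) = (if m = 2 then 1 else 2)"
    using assms(1) by (simp add: s_def reversal_signs_def of_nat_diff algebra_simps)
  ultimately show ?thesis by simp
qed

end
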